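(* Let $G=M(N-1)M(N-2)\cdots M(1)M(0)=(g_{ij})$ be an $n\times n$ matrix all of whose elements $g_{ij}$ are positive, where $M(0),\dots,M(N-1)$ are $n\times n$ matrices with nonnegative entries, and let $\nu_0,\nu_N$ be probability distributions on $\{1,\dots,n\}$. Then the composition $$\mathcal C:=\mathcal E^\dagger\circ\mathcal D_0\circ\mathcal E\circ\mathcal R\circ\mathcal D_N$$ (maps defined in the context) contracts the Hilbert metric with contraction ratio $k(\mathcal C)<\tfrac12$; namely $$d_H(\mathcal C(x),\mathcal C(y))<\tfrac12\,d_H(x,y)$$ for all $x,y\in\mathrm{int}\,\mathbb R^n_+$ that are not positive multiples of each other.
   Context: $\mathbb R^n_+=\{x\in\mathbb R^n: x_i\ge0\}$, and $\mathrm{int}\,\mathbb R^n_+$ is the set of vectors with all positive components. The Hilbert (projective) metric is $d_H(x,y)=\log\max_{i,j}\frac{x_iy_j}{y_ix_j}$ for $x,y\in\mathrm{int}\,\mathbb R^n_+$. For a map $\mathcal F$ sending $\mathrm{int}\,\mathbb R^n_+$ into itself, the contraction ratio is $k(\mathcal F)=\inf\{\lambda\ge0: d_H(\mathcal F(x),\mathcal F(y))\le\lambda\, d_H(x,y)\ \ \forall x,y\in\mathrm{int}\,\mathbb R^n_+\}$. The maps are: - $\mathcal E: x\mapsto y$, $y_i=\sum_j g_{ij}x_j$; - $\mathcal E^\dagger: x\mapsto y$, $y_j=\sum_i g_{ij}x_i$; - $\mathcal D_0: x\mapsto \nu_0/x$ and $\mathcal D_N: x\mapsto\nu_N/x$,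 with componentwise division, where $\nu_0,\nu_N$ are identified with vectors in $\mathbb R^n_+$; - $\mathcal R: x\mapsto(\sqrt{x_1},\dots,\sqrt{x_n})$. $\mathcal C$ is considered as a map on $\mathrm{int}\,\mathbb R^n_+$; the components of $\nu_0$, $\nu_N$ may be zero, but all divisions are well defined because the entries of $G$ are positive. *)

theory Defs
  imports "HOL-Analysis.Analysis" "HOL-Probability.Probability_Mass_Function"
begin

text \<open>The index set \<open>{1..n}\<close> is an arbitrary finite type \<open>'n\<close>.\<close>

definition pos_orthant :: "(real ^ 'n) set"
  where "pos_orthant = {x. \<forall>i. 0 < x $ i}"

text \<open>Only meaningful for \<open>x, y \<in> pos_orthant\<close>.\<close>

definition hilbert_dist :: "real ^ 'n \<Rightarrow> real ^ 'n \<Rightarrow> real"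
  where "hilbert_dist x y =
    ln (Max (range (\<lambda>(i, j). (x $ i * y $ j) / (y $ i * x $ j))))"

text \<open>The infimum is taken in the extended reals, so that it is \<open>\<infinity>\<close> when no
  Lipschitz constant exists; on \<^typ>\<open>real\<close> the infimum of the empty set would be
  an unspecified number.\<close>

definition contraction_ratio :: "(real ^ 'n \<Rightarrow> real ^ 'n) \<Rightarrow> ereal"
  where "contraction_ratio F = (INF l \<in> {l::real. 0 \<le> l \<and>
    (\<forall>x\<in>pos_orthant. \<forall>y\<in>pos_orthant.
      hilbert_dist (F x) (F y) \<le> l * hilbert_dist x y)}. ereal l)"

text \<open>\<open>matrix_chain M N = M (N - 1) ** \<dots> ** M 1 ** M 0\<close>\<close>

primrec matrix_chain :: "(nat \<Rightarrow> real ^ 'n ^ 'n) \<Rightarrow> nat \<Rightarrow> real ^ 'n ^ 'n"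
  where
    "matrix_chain M 0 = mat 1"
  | "matrix_chain M (Suc k) = M k ** matrix_chain M k"

definition divide_into :: "'n pmf \<Rightarrow> real ^ 'n \<Rightarrow> real ^ 'n"
  where "divide_into \<nu> x = (\<chi> i. pmf \<nu> i / x $ i)"

definition sqrt_vec :: "real ^ 'n \<Rightarrow> real ^ 'n"
  where "sqrt_vec x = (\<chi> i. sqrt (x $ i))"

text \<open>For \<open>x \<in> pos_orthant\<close> and entrywise positive \<open>G\<close> both divisions have positive
  denominators: \<open>divide_into \<nu>N x\<close> is nonnegative and nonzero, hence \<open>G *v _\<close> maps its
  componentwise square root into \<open>pos_orthant\<close>.\<close>

definition composed_map ::
    "real ^ 'n ^ 'n \<Rightarrow> 'n pmf \<Rightarrow> 'n pmf \<Rightarrow> real ^ 'n \<Rightarrow> real ^ 'n"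
  where "composed_map G \<nu>0 \<nu>N =
    (\<lambda>z. transpose G *v z) \<circ> divide_into \<nu>0
      \<circ> (\<lambda>z. G *v z) \<circ> sqrt_vec \<circ> divide_into \<nu>N"

end

theory Submission
  imports Defs
begin

text \<open>
  Writing \<open>d\<close> for the Hilbert metric, each of the five factors of \<open>\<C>\<close> acts on
  two-sided estimates \<open>a y \<le> x \<le> b y\<close>, and \<open>d\<close> is the logarithm of the best \<open>b / a\<close>.
  Componentwise division reverses such an estimate to \<open>y' / b \<le> x' \<le> y' / a\<close>, and a
  nonnegative matrix preserves it, so neither increases \<open>d\<close>; the square root
  turns \<open>b / a\<close> into its square root, so it halves \<open>d\<close>. The bound \<open>1/2\<close> becomes strict, and
  uniformly so, because a positive matrix contracts \<open>d\<close> by some factor \<open>1 - \<delta> < 1\<close>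
  (\<open>positive_matrix_contracts\<close>). The two estimates for \<open>\<E> \<circ> \<R> \<circ> \<D>\<^sub>N\<close> and
  \<open>\<E>\<^sup>\<dagger> \<circ> \<D>\<^sub>0\<close> then give \<open>d (\<C> x) (\<C> y) \<le> (1 - \<delta>) / 2 * d x y\<close>.

  The sharp contraction factor of a positive matrix is the one of Birkhoff's theorem, but any
  factor below 1 suffices here, and there is a short argument for one. The ratios
  \<open>(G w)\<^sub>i / (G z)\<^sub>i\<close> are weighted averages of the ratios \<open>w\<^sub>j / z\<^sub>j \<in> [a, b]\<close>, and
  since the rows of \<open>G\<close> are comparable, so are the weights belonging to different \<open>i\<close>.
  Hence any two of these averages, \<open>P\<close> and \<open>R\<close>, satisfy
  \<open>R - a \<ge> \<delta> (P - a)\<close>, where \<open>\<delta> = c\<^sup>2\<close> and \<open>c\<close> is the smallest quotient of two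
  entries of \<open>G\<close> in the same column. As \<open>P \<le> b\<close>, concavity of the logarithm turns this into
  \<open>ln P - ln R \<le> (1 - \<delta>) (ln b - ln a)\<close>.

  The vectors between \<open>\<D>\<^sub>N\<close> and \<open>\<E>\<close> vanish outside the support of \<open>\<nu>\<^sub>N\<close>,
  where the Hilbert metric makes no sense. The two-sided estimates still do, which is why they
  and not \<open>d\<close> are the hypothesis of the contraction lemma.
\<close>

section \<open>The Hilbert metric and two-sided estimates\<close>

definition sandwiched :: "real \<Rightarrow> real \<Rightarrow> real ^ 'n \<Rightarrow> real ^ 'n \<Rightarrow> bool"
  where "sandwiched a b y x \<longleftrightarrow> (\<forall>i. a * y $ i \<le> x $ i \<and> x $ i \<le> b * y $ i)"

lemma hilbert_dist_extremal_ratios: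
  fixes x y :: "real ^ 'n"
  assumes x: "x \<in> pos_orthant" and y: "y \<in> pos_orthant"
  obtains i k where "hilbert_dist x y = ln (x $ i / y $ i) - ln (x $ k / y $ k)"
    and "\<forall>l. x $ l / y $ l \<le> x $ i / y $ i" and "\<forall>l. x $ k / y $ k \<le> x $ l / y $ l"
proof -
  let ?f = "\<lambda>(i, j). (x $ i * y $ j) / (y $ i * x $ j)"
  have pos: "x $ i > 0" "y $ i > 0" for i
    using x y by (auto simp: pos_orthant_def)
  have "Max (range ?f) \<in> range ?f"
    by (intro Max_in) auto
  then obtain p where "Max (range ?f) = ?f p"
    by blast
  then obtain i k where ik: "Max (range ?f) = (x $ i * y $ k) / (y $ i * x $ k)"
    by (cases p) simp
  have max: "(x $ l * y $ m) / (y $ l * x $ m) \<le> (x $ i * y $ k) / (y $ i * x $ k)" for l m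
    unfolding ik[symmetric] by (rule Max_ge) (auto intro!: image_eqI[of _ _ "(l, m)"])
  show thesis
  proof (rule that[of i k])
    show "hilbert_dist x y = ln (x $ i / y $ i) - ln (x $ k / y $ k)"
      using ik pos[of i] pos[of k] by (simp add: hilbert_dist_def ln_div ln_mult)
    have "x $ l / y $ l \<le> x $ i / y $ i" for l
      using max[of l k] pos[of l] pos[of i] pos[of k] by (simp add: field_simps)
    then show "\<forall>l. x $ l / y $ l \<le> x $ i / y $ i" ..
    have "x $ k / y $ k \<le> x $ l / y $ l" for l
      using max[of i l] pos[of l] pos[of i] pos[of k] by (simp add: field_simps)
    then show "\<forall>l. x $ k / y $ k \<le> x $ l / y $ l" ..
  qed
qed

lemma hilbert_dist_leI:
  fixes x y :: "real ^ 'n"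
  assumes x: "x \<in> pos_orthant" and y: "y \<in> pos_orthant"
    and r: "\<And>i k. ln (x $ i / y $ i) - ln (x $ k / y $ k) \<le> r"
  shows "hilbert_dist x y \<le> r"
proof -
  obtain i k where "hilbert_dist x y = ln (x $ i / y $ i) - ln (x $ k / y $ k)"
    by (rule hilbert_dist_extremal_ratios[OF x y])
  then show ?thesis
    using r by simp
qed

lemma hilbert_dist_le_sandwiched:
  fixes x y :: "real ^ 'n"
  assumes x: "x \<in> pos_orthant" and y: "y \<in> pos_orthant"
    and s: "sandwiched a b y x" and a: "0 < a" and b: "0 < b"
  shows "hilbert_dist x y \<le> ln b - ln a"
proof (rule hilbert_dist_leI[OF x y])
  fix i k
  have pos: "x $ i > 0" "y $ i > 0" for i
    using x y by (auto simp: pos_orthant_def)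
  have "x $ i / y $ i \<le> b" "a \<le> x $ k / y $ k"
    using s pos[of i] pos[of k] by (auto simp: sandwiched_def field_simps)
  then have "ln (x $ i / y $ i) \<le> ln b" "ln a \<le> ln (x $ k / y $ k)"
    using pos a b by (auto intro!: ln_mono)
  then show "ln (x $ i / y $ i) - ln (x $ k / y $ k) \<le> ln b - ln a"
    by simp
qed

lemma hilbert_dist_attained:
  fixes x y :: "real ^ 'n"
  assumes x: "x \<in> pos_orthant" and y: "y \<in> pos_orthant"
  obtains a b where "0 < a" "a \<le> b" "sandwiched a b y x" "hilbert_dist x y = ln b - ln a"
proof -
  obtain i k where dist: "hilbert_dist x y = ln (x $ i / y $ i) - ln (x $ k / y $ k)"
    and upper: "\<forall>l. x $ l / y $ l \<le> x $ i / y $ i"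
    and lower: "\<forall>l. x $ k / y $ k \<le> x $ l / y $ l"
    using hilbert_dist_extremal_ratios[OF x y] .
  have pos: "x $ i > 0" "y $ i > 0" for i
    using x y by (auto simp: pos_orthant_def)
  show thesis
  proof (rule that[OF _ _ _ dist])
    show "sandwiched (x $ k / y $ k) (x $ i / y $ i) y x"
      using upper lower
      by (simp only: sandwiched_def pos(2) simp_thms flip: pos_le_divide_eq pos_divide_le_eq)
  qed (use pos upper in auto)
qed

lemma hilbert_dist_pos:
  fixes x y :: "real ^ 'n"
  assumes x: "x \<in> pos_orthant" and y: "y \<in> pos_orthant"
    and not_multiple: "\<not> (\<exists>c>0. x = c *\<^sub>R y)"
  shows "0 < hilbert_dist x y"
proof -
  obtain a b where ab: "0 < a" "a \<le> b" "sandwiched a b y x" "hilbert_dist x y = ln b - ln a"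
    using hilbert_dist_attained[OF x y] .
  have "a \<noteq> b"
  proof
    assume "a = b"
    then have "x = a *\<^sub>R y"
      using ab(3) by (auto simp: sandwiched_def vec_eq_iff intro: antisym)
    with not_multiple ab(1) show False
      by blast
  qed
  then show ?thesis
    using ab by simp
qed

section \<open>Nonnegative and positive matrices\<close>

lemma matrix_vector_mult_mono:
  fixes A :: "real ^ 'n ^ 'm"
  assumes "\<And>i j. 0 \<le> A $ i $ j" and "\<And>j. u $ j \<le> v $ j"
  shows "(A *v u) $ i \<le> (A *v v) $ i"
  using assms by (auto simp: matrix_vector_mult_def intro!: sum_mono mult_left_mono)

lemma sandwiched_matrix_vector_mult:
  fixes A :: "real ^ 'n ^ 'm"
  assumes A: "\<And>i j. 0 \<le> A $ i $ j" and s: "sandwiched a b z w"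
  shows "sandwiched a b (A *v z) (A *v w)"
proof -
  have "(A *v (a *\<^sub>R z)) $ i \<le> (A *v w) $ i" "(A *v w) $ i \<le> (A *v (b *\<^sub>R z)) $ i" for i
    using s by (auto simp: sandwiched_def intro!: matrix_vector_mult_mono A)
  then show ?thesis
    by (simp add: sandwiched_def matrix_vector_mult_scaleR)
qed

lemma positive_matrix_maps_into_pos_orthant:
  fixes A :: "real ^ 'n ^ 'm"
  assumes A: "\<And>i j. 0 < A $ i $ j" and "\<And>j. 0 \<le> v $ j" and "0 < v $ k"
  shows "A *v v \<in> pos_orthant"
proof -
  have "0 < (\<Sum>j\<in>UNIV. A $ i $ j * v $ j)" for i
    using assms by (intro sum_pos2[where i = k]) (auto intro!: mult_nonneg_nonneg less_imp_le[OF A])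
  then show ?thesis
    by (simp add: pos_orthant_def matrix_vector_mult_def)
qed

lemma positive_matrix_rows_comparable:
  fixes A :: "real ^ 'n ^ 'm"
  assumes A: "\<And>i j. 0 < A $ i $ j"
  obtains c where "0 < c" "c \<le> 1" "\<forall>i k j. c * A $ k $ j \<le> A $ i $ j"
proof -
  let ?f = "\<lambda>(i, k, j). A $ i $ j / A $ k $ j"
  let ?c = "Min (range ?f)"
  have c_le: "?c \<le> A $ i $ j / A $ k $ j" for i k j
    by (rule Min_le) (auto intro!: image_eqI[of _ _ "(i, k, j)"])
  have "?c \<in> range ?f"
    by (intro Min_in) auto
  then have "0 < ?c"
    using A by (auto simp: less_imp_le)
  moreover have "?c \<le> 1"
    using c_le[of undefined undefined undefined] A by (simp add: less_imp_neq[symmetric])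
  moreover have "?c * A $ k $ j \<le> A $ i $ j" for i k j
    using c_le[of i j k] A by (simp add: pos_le_divide_eq)
  ultimately show thesis
    using that by blast
qed

text \<open>The excess \<open>u = w - a z\<close> is nonnegative, so comparability of the rows with
  constant \<open>c\<close> bounds \<open>(G u)\<^sub>k\<close> below by \<open>c (G u)\<^sub>i\<close>; passing to the ratios
  \<open>(G u)\<^sub>k / (G z)\<^sub>k\<close> compares \<open>(G z)\<^sub>k\<close> and \<open>(G z)\<^sub>i\<close> as well, whence the
  second factor \<open>c\<close>.\<close>

lemma positive_matrix_contracts:
  fixes A :: "real ^ 'n ^ 'm"
  assumes A: "\<And>i j. 0 \<le> A $ i $ j" and rows: "\<forall>i k j. c * A $ k $ j \<le> A $ i $ j"
    and c: "0 < c" "c \<le> 1"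
    and z: "\<And>j. 0 \<le> z $ j" and Az: "A *v z \<in> pos_orthant" and Aw: "A *v w \<in> pos_orthant"
    and s: "sandwiched a b z w" and a: "0 < a"
  shows "hilbert_dist (A *v w) (A *v z) \<le> (1 - c\<^sup>2) * (ln b - ln a)"
proof (rule hilbert_dist_leI[OF Aw Az])
  fix i k
  define P where "P = (A *v w) $ i / (A *v z) $ i"
  define R where "R = (A *v w) $ k / (A *v z) $ k"
  have pos: "(A *v z) $ l > 0" "(A *v w) $ l > 0" for l
    using Az Aw by (auto simp: pos_orthant_def)
  have rows_vec: "c * (A *v v) $ l \<le> (A *v v) $ m" if "\<And>j. 0 \<le> v $ j" for v l m
    using mult_right_mono[OF rows[rule_format] that]
    by (auto simp: matrix_vector_mult_def sum_distrib_left mult.assoc[symmetric] intro!: sum_mono)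
  define u where "u = w - a *\<^sub>R z"
  have u: "0 \<le> u $ j" for j
    using s by (simp add: u_def sandwiched_def)
  have ratio: "(A *v u) $ l / (A *v z) $ l = (A *v w) $ l / (A *v z) $ l - a" for l
    using pos[of l]
    by (simp add: u_def matrix_vector_mult_diff_distrib matrix_vector_mult_scaleR diff_divide_distrib)
  have "c\<^sup>2 * (P - a) = (c * (A *v u) $ i) * (c / (A *v z) $ i)"
    by (simp add: P_def power2_eq_square flip: ratio)
  also have "\<dots> \<le> (A *v u) $ k * (1 / (A *v z) $ k)"
  proof (rule mult_mono)
    show "c / (A *v z) $ i \<le> 1 / (A *v z) $ k"
      using rows_vec[of z k i, OF z] pos by (simp add: field_simps)
    show "0 \<le> (A *v u) $ k"
      using A u by (auto simp: matrix_vector_mult_def intro!: sum_nonneg)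
  qed (use rows_vec u c pos in \<open>auto simp: less_imp_le\<close>)
  also have "\<dots> = R - a"
    by (simp add: R_def flip: ratio)
  finally have R_ge: "(1 - c\<^sup>2) * a + c\<^sup>2 * P \<le> R"
    by (simp add: algebra_simps)
  have P: "0 < P" "a \<le> P" "P \<le> b"
    using sandwiched_matrix_vector_mult[OF A s] pos[of i]
    by (simp_all add: P_def sandwiched_def pos_le_divide_eq pos_divide_le_eq)
  have c2: "0 \<le> c\<^sup>2" "c\<^sup>2 \<le> 1"
    using c by (auto simp: power_le_one)
  \<comment> \<open>A bound linear in \<open>P\<close> becomes one linear in \<open>ln P\<close>; this is the step that makes the
    contraction factor independent of \<open>b / a\<close>.\<close>
  have "(1 - c\<^sup>2) * ln a + c\<^sup>2 * ln P \<le> ln ((1 - c\<^sup>2) * a + c\<^sup>2 * P)"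
    using concave_onD[OF ln_concave c2, of a P] a P by simp
  also have "\<dots> \<le> ln R"
    using R_ge c c2 P a by (intro ln_mono add_nonneg_pos) auto
  finally have "(1 - c\<^sup>2) * ln a + c\<^sup>2 * ln P \<le> ln R" .
  then have "ln P - ln R \<le> (1 - c\<^sup>2) * (ln P - ln a)"
    by (simp add: algebra_simps)
  also have "\<dots> \<le> (1 - c\<^sup>2) * (ln b - ln a)"
    using P c2 by (intro mult_left_mono) auto
  finally show "ln ((A *v w) $ i / (A *v z) $ i) - ln ((A *v w) $ k / (A *v z) $ k)
      \<le> (1 - c\<^sup>2) * (ln b - ln a)"
    by (simp add: P_def R_def)
qed

section \<open>The factors of the composed map\<close>

lemma sandwiched_divide_into:
  assumes x: "x \<in> pos_orthant" and y: "y \<in> pos_orthant"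
    and s: "sandwiched a b y x" and a: "0 < a" and b: "0 < b"
  shows "sandwiched (1 / b) (1 / a) (divide_into \<nu> y) (divide_into \<nu> x)"
  unfolding sandwiched_def
proof (intro allI conjI)
  fix i
  have pos: "x $ i > 0" "y $ i > 0"
    using x y by (auto simp: pos_orthant_def)
  have "pmf \<nu> i / (b * y $ i) \<le> pmf \<nu> i / x $ i" "pmf \<nu> i / x $ i \<le> pmf \<nu> i / (a * y $ i)"
    using s a b pos by (auto simp: sandwiched_def intro!: divide_left_mono)
  then show "1 / b * divide_into \<nu> y $ i \<le> divide_into \<nu> x $ i"
    and "divide_into \<nu> x $ i \<le> 1 / a * divide_into \<nu> y $ i"
    by (simp_all add: divide_into_def)
qed

lemma sandwiched_sqrt_vec:
  assumes "sandwiched a b z w"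
  shows "sandwiched (sqrt a) (sqrt b) (sqrt_vec z) (sqrt_vec w)"
  using assms by (auto simp: sandwiched_def sqrt_vec_def simp flip: real_sqrt_mult)

lemma divide_into_nonneg:
  assumes "x \<in> pos_orthant"
  shows "0 \<le> divide_into \<nu> x $ i"
  using assms by (auto simp: divide_into_def pos_orthant_def less_imp_le)

lemma divide_into_has_pos_component:
  assumes "x \<in> pos_orthant"
  obtains i where "0 < divide_into \<nu> x $ i"
proof -
  obtain i where "i \<in> set_pmf \<nu>"
    using set_pmf_not_empty[of \<nu>] by blast
  then show thesis
    using that[of i] assms by (auto simp: divide_into_def pos_orthant_def pmf_positive)
qed

lemma positive_matrix_divide_into_pos:
  assumes A: "\<And>i j. 0 < A $ i $ j" and x: "x \<in> pos_orthant"
  shows "A *v divide_into \<nu> x \<in> pos_orthant"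
proof -
  obtain k where "0 < divide_into \<nu> x $ k"
    using divide_into_has_pos_component[OF x] .
  with A divide_into_nonneg[OF x] show ?thesis
    by (rule positive_matrix_maps_into_pos_orthant)
qed

lemma positive_matrix_sqrt_divide_into_pos:
  assumes A: "\<And>i j. 0 < A $ i $ j" and x: "x \<in> pos_orthant"
  shows "A *v sqrt_vec (divide_into \<nu> x) \<in> pos_orthant"
proof -
  obtain k where "0 < divide_into \<nu> x $ k"
    using divide_into_has_pos_component[OF x] .
  then show ?thesis
    using divide_into_nonneg[OF x]
    by (intro positive_matrix_maps_into_pos_orthant[OF A, of _ k]) (auto simp: sqrt_vec_def)
qed

lemma positive_matrix_divide_into_nonexpansive:
  assumes A: "\<And>i j. 0 < A $ i $ j" and x: "x \<in> pos_orthant" and y: "y \<in> pos_orthant"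
  shows "hilbert_dist (A *v divide_into \<nu> x) (A *v divide_into \<nu> y) \<le> hilbert_dist x y"
proof -
  obtain a b where ab: "0 < a" "a \<le> b" "sandwiched a b y x" "hilbert_dist x y = ln b - ln a"
    using hilbert_dist_attained[OF x y] .
  have "sandwiched (1 / b) (1 / a) (A *v divide_into \<nu> y) (A *v divide_into \<nu> x)"
    using ab A x y by (intro sandwiched_matrix_vector_mult sandwiched_divide_into) (auto simp: less_imp_le)
  then have "hilbert_dist (A *v divide_into \<nu> x) (A *v divide_into \<nu> y) \<le> ln (1 / a) - ln (1 / b)"
    using ab A x y by (intro hilbert_dist_le_sandwiched positive_matrix_divide_into_pos) auto
  then show ?thesis
    using ab by (simp add: ln_div)
qed

text \<open>Here the factor 1/2 comes from the square root, and the factor \<open>1 - c\<^sup>2\<close> from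
  the matrix.\<close>

lemma positive_matrix_sqrt_divide_into_contracts:
  assumes A: "\<And>i j. 0 < A $ i $ j" and rows: "\<forall>i k j. c * A $ k $ j \<le> A $ i $ j"
    and c: "0 < c" "c \<le> 1" and x: "x \<in> pos_orthant" and y: "y \<in> pos_orthant"
  shows "hilbert_dist (A *v sqrt_vec (divide_into \<nu> x)) (A *v sqrt_vec (divide_into \<nu> y))
    \<le> (1 - c\<^sup>2) / 2 * hilbert_dist x y"
proof -
  obtain a b where ab: "0 < a" "a \<le> b" "sandwiched a b y x" "hilbert_dist x y = ln b - ln a"
    using hilbert_dist_attained[OF x y] .
  have "sandwiched (sqrt (1 / b)) (sqrt (1 / a))
      (sqrt_vec (divide_into \<nu> y)) (sqrt_vec (divide_into \<nu> x))"
    using ab x y by (intro sandwiched_sqrt_vec sandwiched_divide_into) auto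
  moreover have "0 \<le> sqrt_vec (divide_into \<nu> y) $ j" for j
    using divide_into_nonneg[OF y] by (simp add: sqrt_vec_def)
  ultimately have "hilbert_dist (A *v sqrt_vec (divide_into \<nu> x)) (A *v sqrt_vec (divide_into \<nu> y))
      \<le> (1 - c\<^sup>2) * (ln (sqrt (1 / a)) - ln (sqrt (1 / b)))"
    using ab A rows c x y
    by (intro positive_matrix_contracts positive_matrix_sqrt_divide_into_pos) (auto simp: less_imp_le)
  also have "ln (sqrt (1 / a)) - ln (sqrt (1 / b)) = hilbert_dist x y / 2"
    using ab by (simp add: ln_sqrt ln_div field_simps)
  finally show ?thesis
    by simp
qed

section \<open>Contraction of the composed map\<close>

theorem theorem9:
  fixes M :: "nat \<Rightarrow> real ^ 'n ^ 'n" and N :: nat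
    and G :: "real ^ 'n ^ 'n" and \<nu>0 \<nu>N :: "'n pmf"
  assumes M_nonneg: "\<And>k i j. k < N \<Longrightarrow> 0 \<le> M k $ i $ j"
    and G_eq: "G = matrix_chain M N"
    and G_pos: "\<And>i j. 0 < G $ i $ j"
  shows "composed_map G \<nu>0 \<nu>N ` pos_orthant \<subseteq> pos_orthant
    \<and> contraction_ratio (composed_map G \<nu>0 \<nu>N) < ereal (1 / 2)
    \<and> (\<forall>x\<in>pos_orthant. \<forall>y\<in>pos_orthant.
          \<not> (\<exists>c>0. x = c *\<^sub>R y) \<longrightarrow>
          hilbert_dist (composed_map G \<nu>0 \<nu>N x) (composed_map G \<nu>0 \<nu>N y)
            < 1 / 2 * hilbert_dist x y)"
proof -
  let ?C = "composed_map G \<nu>0 \<nu>N"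
  let ?inner = "\<lambda>x. G *v sqrt_vec (divide_into \<nu>N x)"
  obtain c where c: "0 < c" "c \<le> 1" and rows: "\<forall>i k j. c * G $ k $ j \<le> G $ i $ j"
    using positive_matrix_rows_comparable[OF G_pos] .
  define l where "l = (1 - c\<^sup>2) / 2"
  have l: "0 \<le> l" "l < 1 / 2"
    using c by (auto simp: l_def power_le_one)
  have C: "?C x = transpose G *v divide_into \<nu>0 (?inner x)" for x
    by (simp add: composed_map_def)
  have Gt_pos: "0 < transpose G $ i $ j" for i j
    using G_pos by (simp add: transpose_def)
  have inner: "?inner x \<in> pos_orthant" if "x \<in> pos_orthant" for x
    using G_pos that by (rule positive_matrix_sqrt_divide_into_pos)
  have maps: "?C ` pos_orthant \<subseteq> pos_orthant"
    using positive_matrix_divide_into_pos[OF Gt_pos inner] by (auto simp: C)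
  have contracts: "hilbert_dist (?C x) (?C y) \<le> l * hilbert_dist x y"
    if x: "x \<in> pos_orthant" and y: "y \<in> pos_orthant" for x y
  proof -
    have "hilbert_dist (?C x) (?C y) \<le> hilbert_dist (?inner x) (?inner y)"
      unfolding C using Gt_pos inner[OF x] inner[OF y]
      by (rule positive_matrix_divide_into_nonexpansive)
    also have "\<dots> \<le> l * hilbert_dist x y"
      unfolding l_def using G_pos rows c x y
      by (rule positive_matrix_sqrt_divide_into_contracts)
    finally show ?thesis .
  qed
  have "contraction_ratio ?C \<le> ereal l"
    unfolding contraction_ratio_def using l contracts by (intro INF_lower) auto
  also have "\<dots> < ereal (1 / 2)"
    using l by simp
  finally have ratio: "contraction_ratio ?C < ereal (1 / 2)" .
  have strict: "hilbert_dist (?C x) (?C y) < 1 / 2 * hilbert_dist x y"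
    if "x \<in> pos_orthant" "y \<in> pos_orthant" "\<not> (\<exists>c>0. x = c *\<^sub>R y)" for x y
  proof -
    have "l * hilbert_dist x y < 1 / 2 * hilbert_dist x y"
      using l hilbert_dist_pos[OF that] by (intro mult_strict_right_mono)
    with contracts[OF that(1,2)] show ?thesis
      by linarith
  qed
  show ?thesis
    using maps ratio strict by blast
qed

end
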